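(* For any $k\in\mathbb{N}$ there exists a hollow affine $(k-1)$-crystal $C\in\mathcal{T}^{\frac{k^2+k}{2}\cdot\mathbf{1}_k}(\mathbb{Z})$.
   Context: For $n,q\in\mathbb{N}$, $\mathcal{T}^{n\cdot\mathbf{1}_q}(\mathbb{Z})$ is the set of functions $C:[n]^q\to\mathbb{Z}$, where $[n]=\{1,\dots,n\}$. For a tuple $\mathbf{b}=(b_1,\dots,b_q)$ and $\mathbf{i}=(i_1,\dots,i_p)\in[q]^p$, $\mathbf{b}_{\mathbf{i}}=(b_{i_1},\dots,b_{i_p})$ (for $p=0$ this is the empty tuple, and $[n]^0$ has one element, the empty tuple). The projection of $C$ onto $\mathbf{i}\in[q]^p$ is $\Pi_{\mathbf{i}}*C:[n]^p\to\mathbb{Z}$, $(\Pi_{\mathbf{i}}*C)(\mathbf{a})=\sum_{\mathbf{b}\in[n]^q,\ \mathbf{b}_{\mathbf{i}}=\mathbf{a}}C(\mathbf{b})$. Let $[q]^h_\to$ be the set of strictly increasing tuples in $[q]^h$ (with $[q]^0_\to$ consisting of the empty tuple). For $h\in\{0,\dots,q\}$, $C$ is an $h$-crystal if $\Pi_{\mathbf{i}}*C=\Pi_{\mathbf{j}}*C$ for all $\mathbf{i},\mathbf{j}\in[q]^h_\to$. $C$ is affine if its entries sum to $1$. $C:[n]^q\to\mathbb{Z}$ is hollow if $C(\mathbf{a})=0$ for every $\mathbf{a}\in[n]^q$ whose entries are not pairwise distinct. *)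

theory Defs
  imports Main "HOL-Library.FuncSet"
begin

text \<open>
  A tuple in \<open>[n]\<^sup>q\<close> is a list of length \<open>q\<close> with entries in \<open>{1..n}\<close>; for \<open>q = 0\<close> the only
  tuple is \<open>[]\<close>.
\<close>

definition tuples :: "nat \<Rightarrow> nat \<Rightarrow> nat list set" where
  "tuples n q = {a. length a = q \<and> set a \<subseteq> {1..n}}"

definition incr_tuples :: "nat \<Rightarrow> nat \<Rightarrow> nat list set" where
  "incr_tuples q h = {i \<in> tuples q h. sorted_wrt (<) i}"

text \<open>
  \<open>subtuple b i\<close> is \<open>b\<^sub>i\<close>. The positions listed in \<open>i\<close> are counted from 1, whereas list
  positions are counted from 0, hence the shift.
\<close>

definition subtuple :: "nat list \<Rightarrow> nat list \<Rightarrow> nat list" where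
  "subtuple b i = map (\<lambda>j. b ! (j - 1)) i"

text \<open>
  The functions \<open>[n]\<^sup>q \<rightarrow> \<int>\<close> are extensional functions, so that their equality in HOL is
  equality on \<open>[n]\<^sup>q\<close>.
\<close>

definition tensors :: "nat \<Rightarrow> nat \<Rightarrow> (nat list \<Rightarrow> int) set" where
  "tensors n q = tuples n q \<rightarrow>\<^sub>E UNIV"

definition projection :: "nat \<Rightarrow> nat \<Rightarrow> nat list \<Rightarrow> (nat list \<Rightarrow> int) \<Rightarrow> (nat list \<Rightarrow> int)" where
  "projection n q i C =
     (\<lambda>a \<in> tuples n (length i). \<Sum>b \<in> {b \<in> tuples n q. subtuple b i = a}. C b)"

definition crystal :: "nat \<Rightarrow> nat \<Rightarrow> nat \<Rightarrow> (nat list \<Rightarrow> int) \<Rightarrow> bool" where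
  "crystal n q h C \<longleftrightarrow> h \<le> q \<and>
     (\<forall>i \<in> incr_tuples q h. \<forall>j \<in> incr_tuples q h. projection n q i C = projection n q j C)"

definition affine_tensor :: "nat \<Rightarrow> nat \<Rightarrow> (nat list \<Rightarrow> int) \<Rightarrow> bool" where
  "affine_tensor n q C \<longleftrightarrow> (\<Sum>a \<in> tuples n q. C a) = 1"

definition hollow :: "nat \<Rightarrow> nat \<Rightarrow> (nat list \<Rightarrow> int) \<Rightarrow> bool" where
  "hollow n q C \<longleftrightarrow> (\<forall>a \<in> tuples n q. \<not> distinct a \<longrightarrow> C a = 0)"

end

theory Submission imports Defs begin

text \<open>
  Build hollow affine crystals \<open>C\<^sub>m\<close> on \<open>1 + \<dots> + m\<close> letters such that erasing any one
  position of \<open>C\<^sub>m\<close> yields \<open>C\<^sub>m\<^sub>-\<^sub>1\<close>. Use \<open>m\<close> new letters \<open>x\<^sub>1, \<dots>, x\<^sub>m\<close>, where \<open>x\<^sub>i\<close> may occur at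
  position \<open>i\<close> only, and put
  \<open>C\<^sub>m = (\<Sum>S \<noteq> {}. (-1)\<^bsup>|S| + 1\<^esup> x\<^sub>S \<otimes> C\<^bsub>m - |S|\<^esub>)\<close>: the new letters fill the
  positions in \<open>S \<subseteq> [m]\<close> and \<open>C\<^bsub>m - |S|\<^esub>\<close> fills the others. When position \<open>j\<close> is erased, the term
  of \<open>S\<close> with \<open>j \<notin> S\<close> cancels against the term of \<open>S \<union> {j}\<close>; only \<open>S = {j}\<close>
  remains, and it gives \<open>C\<^sub>m\<^sub>-\<^sub>1\<close>.
\<close>

section \<open>Alphabet sizes and placement of new letters\<close>

definition triangle :: "nat \<Rightarrow> nat" where
  "triangle m = (m^2 + m) div 2"

lemma triangle_Suc: "triangle (Suc m) = triangle m + Suc m"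
proof -
  have "(Suc m)^2 + Suc m = (m^2 + m) + Suc m * 2"
    by (simp add: power2_eq_square)
  then show ?thesis
    unfolding triangle_def by (metis add.commute div_mult_self1 zero_neq_numeral)
qed

lemma triangle_mono: "m \<le> n \<Longrightarrow> triangle m \<le> triangle n"
  by (rule lift_Suc_mono_le) (simp_all add: triangle_Suc)

text \<open>Letters above \<open>N\<close> are new; the second argument is the position of the head of the list,
  counted from 0.\<close>

fun well_placed :: "nat \<Rightarrow> nat \<Rightarrow> nat list \<Rightarrow> bool" where
  "well_placed N p [] \<longleftrightarrow> True"
| "well_placed N p (x # xs) \<longleftrightarrow> (x \<le> N \<or> x = N + Suc p) \<and> well_placed N (Suc p) xs"

lemma well_placed_append:
  "well_placed N p (xs @ ys) \<longleftrightarrow> well_placed N p xs \<and> well_placed N (p + length xs) ys"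
  by (induction xs arbitrary: p) auto

lemma well_placed_old: "\<forall>x\<in>set xs. x \<le> N \<Longrightarrow> well_placed N p xs"
  by (induction xs arbitrary: p) auto

lemma well_placed_bounds:
  "well_placed N p xs \<Longrightarrow> x \<in> set xs \<Longrightarrow> x \<le> N \<or> N + p < x \<and> x \<le> N + p + length xs"
  by (induction xs arbitrary: p) fastforce+

text \<open>A new letter determines its own position and so cannot repeat; any repetition would be
  among the old letters.\<close>

lemma well_placed_distinct:
  "well_placed N p xs \<Longrightarrow> distinct (filter (\<lambda>x. x \<le> N) xs) \<Longrightarrow> distinct xs"
proof (induction xs arbitrary: p)
  case (Cons x xs)
  have "x \<notin> set xs"
  proof
    assume "x \<in> set xs"
    with Cons.prems well_placed_bounds[of N "Suc p" xs x] show False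
      by (auto split: if_splits)
  qed
  with Cons show ?case
    by (auto split: if_splits)
qed simp

section \<open>The crystals and their support\<close>

text \<open>The value of \<open>C\<^sub>m\<close> at \<open>w\<close>, for all \<open>m\<close> at once: \<open>m\<close> is the length of \<open>w\<close>.\<close>

function weight :: "nat list \<Rightarrow> int" where
  "weight w =
     (if w = [] then 1
      else let N = triangle (length w - 1) in
        if well_placed N 0 w \<and> (\<exists>x\<in>set w. N < x)
        then - ((-1) ^ length (filter (\<lambda>x. N < x) w)) * weight (filter (\<lambda>x. x \<le> N) w)
        else 0)"
  by auto
text \<open>The recursive call needs a new letter (\<open>S\<close> is nonempty), so filtering
  shortens the word.\<close>

termination
  by (relation "measure length") (auto intro: length_filter_less simp: not_le)

declare weight.simps [simp del]

lemma weight_Nil [simp]: "weight [] = 1"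
  by (simp add: weight.simps)

lemma weight_length_Suc:
  assumes "length w = Suc m"
  shows "weight w =
     (if well_placed (triangle m) 0 w \<and> (\<exists>x\<in>set w. triangle m < x)
      then - ((-1) ^ length (filter (\<lambda>x. triangle m < x) w))
           * weight (filter (\<lambda>x. x \<le> triangle m) w)
      else 0)"
  using assms by (subst weight.simps) (auto simp: Let_def)

text \<open>A word of length \<open>Suc m\<close> with nonzero weight has letters at most
  \<open>triangle m + Suc m\<close>. Hence enlarging the alphabet adds only zero terms to a sum of
  weights.\<close>

lemma weight_eq_0_if_large:
  assumes "x \<in> set w" "triangle (length w) < x"
  shows "weight w = 0"
proof -
  obtain m where m: "length w = Suc m"
    using assms(1) by (cases w) auto
  have "\<not> well_placed (triangle m) 0 w"
    using well_placed_bounds[of "triangle m" 0 w x] assms m by (auto simp: triangle_Suc)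
  then show ?thesis
    by (simp add: weight_length_Suc[OF m])
qed

lemma weight_nonzero_distinct: "weight w \<noteq> 0 \<Longrightarrow> distinct w"
proof (induction "length w" arbitrary: w rule: less_induct)
  case less
  show ?case
  proof (cases "length w")
    case (Suc m)
    let ?u = "filter (\<lambda>x. x \<le> triangle m) w"
    have w: "well_placed (triangle m) 0 w" "\<exists>x\<in>set w. triangle m < x" "weight ?u \<noteq> 0"
      using less.prems by (auto simp: weight_length_Suc[OF Suc] split: if_splits)
    have "length ?u < length w"
      using w(2) by (meson length_filter_less not_le)
    then show ?thesis
      using less.hyps w well_placed_distinct by blast
  qed simp
qed

section \<open>Erasing one position\<close>

lemma sum_weight_insert:
  assumes "triangle (Suc (length (xs @ ys))) \<le> n"
  shows "(\<Sum>x\<in>{1..n}. weight (xs @ x # ys)) = weight (xs @ ys)"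
  using assms
proof (induction "length (xs @ ys)" arbitrary: xs ys rule: less_induct)
  case less
  define m where "m = length (xs @ ys)"
  define N where "N = triangle m"
  define old where "old = filter (\<lambda>x. x \<le> N)"
  \<comment> \<open>With \<open>S\<close> the set of positions of new letters and \<open>j\<close>
    the inserted position, \<open>c\<close> is the size of \<open>S\<close> without
    \<open>j\<close>.\<close>
  define c where "c = length (filter (\<lambda>x. N < x) (xs @ ys))"
  define good where
    "good \<longleftrightarrow> well_placed N 0 xs \<and> well_placed N (Suc (length xs)) ys"
  let ?new = "N + Suc (length xs)"
  have len: "length (xs @ x # ys) = Suc m" for x
    by (simp add: m_def)
  note weight_ins = weight_length_Suc[OF len, folded N_def]
  have N_le: "N + Suc m \<le> n"
    using less.prems by (simp add: N_def m_def triangle_Suc)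
  \<comment> \<open>Here \<open>j\<close> is not in \<open>S\<close>, so \<open>S\<close> is
    nonempty only if \<open>c \<noteq> 0\<close>.\<close>
  have old_letter: "weight (xs @ x # ys) =
      (if good \<and> c \<noteq> 0 then - ((-1) ^ c) * weight (old xs @ x # old ys) else 0)" if "x \<le> N" for x
    using that
    by (auto simp: weight_ins good_def c_def old_def well_placed_append filter_empty_conv)
  \<comment> \<open>Here \<open>j\<close> is in \<open>S\<close>, so \<open>S\<close> has size
    \<open>c + 1\<close> and the sign flips.\<close>
  have new_letter: "weight (xs @ ?new # ys) =
      (if good then (-1) ^ c * weight (old xs @ old ys) else 0)"
    by (auto simp: weight_ins good_def c_def old_def well_placed_append)
  have other_letter: "weight (xs @ x # ys) = 0" if "N < x" "x \<noteq> ?new" for x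
    using that by (auto simp: weight_ins well_placed_append)
  \<comment> \<open>Since \<open>c \<noteq> 0\<close>, the old word is shorter and induction
    applies. The induction keeps \<open>n\<close> fixed, so the sum is first extended from
    \<open>N\<close> to \<open>n\<close> by zero terms.\<close>
  have old_sum: "(\<Sum>x\<in>{1..N}. weight (old xs @ x # old ys)) = weight (old xs @ old ys)"
    if c: "c \<noteq> 0"
  proof -
    obtain x where "x \<in> set (xs @ ys)" "\<not> x \<le> N"
      using c by (fastforce simp: c_def filter_empty_conv)
    then have "length (old (xs @ ys)) < m"
      unfolding m_def old_def by (rule length_filter_less)
    then have lt: "length (old xs @ old ys) < m"
      by (simp add: old_def)
    then have "triangle (Suc (length (old xs @ old ys))) \<le> N"
      unfolding N_def by (intro triangle_mono) simp
    have "(\<Sum>x\<in>{1..N}. weight (old xs @ x # old ys)) =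
      (\<Sum>x\<in>{1..n}. weight (old xs @ x # old ys))"
    proof (rule sum.mono_neutral_left)
      show "\<forall>x\<in>{1..n} - {1..N}. weight (old xs @ x # old ys) = 0"
      proof
        fix x assume "x \<in> {1..n} - {1..N}"
        with \<open>triangle _ \<le> N\<close> show "weight (old xs @ x # old ys) = 0"
          by (intro weight_eq_0_if_large[of x]) auto
      qed
    qed (use N_le in auto)
    also have "\<dots> = weight (old xs @ old ys)"
      using less.hyps[of "old xs" "old ys"] lt \<open>triangle _ \<le> N\<close> N_le by (simp add: m_def)
    finally show ?thesis .
  qed
  have "(\<Sum>x\<in>{1..n}. weight (xs @ x # ys)) = (\<Sum>x\<in>insert ?new {1..N}. weight (xs @ x # ys))"
  proof (rule sum.mono_neutral_right)
    show "\<forall>x\<in>{1..n} - insert ?new {1..N}. weight (xs @ x # ys) = 0"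
    proof
      fix x assume "x \<in> {1..n} - insert ?new {1..N}"
      then show "weight (xs @ x # ys) = 0"
        by (intro other_letter) auto
    qed
  qed (use N_le in \<open>auto simp: m_def\<close>)
  also have "\<dots> = weight (xs @ ?new # ys) + (\<Sum>x\<in>{1..N}. weight (xs @ x # ys))"
    by simp
  also have "(\<Sum>x\<in>{1..N}. weight (xs @ x # ys)) =
      (if good \<and> c \<noteq> 0 then - ((-1) ^ c) * weight (old xs @ old ys) else 0)"
    using old_sum
    by (cases "good \<and> c \<noteq> 0") (auto simp: old_letter sum_negf simp flip: sum_distrib_left)
  \<comment> \<open>If \<open>c = 0\<close>, only \<open>S = {j}\<close> contributes. Otherwise the
    two terms cancel, and \<open>xs @ ys\<close> contains a letter above \<open>triangle m\<close>,
    so its weight is zero too.\<close>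
  also have "weight (xs @ ?new # ys) + \<dots> = weight (xs @ ys)"
  proof (cases "c = 0")
    case True
    then have le: "\<forall>x\<in>set (xs @ ys). x \<le> N"
      by (auto simp: c_def filter_empty_conv not_less)
    then have "old xs = xs" "old ys = ys" good
      by (auto simp: old_def good_def intro: well_placed_old)
    with True show ?thesis
      unfolding new_letter by simp
  next
    case False
    then obtain x where "x \<in> set (xs @ ys)" "N < x"
      by (auto simp: c_def filter_empty_conv)
    then have "weight (xs @ ys) = 0"
      unfolding N_def m_def by (rule weight_eq_0_if_large)
    with False show ?thesis
      unfolding new_letter by simp
  qed
  finally show ?case .
qed

lemma tuples_Suc: "tuples n (Suc q) = (\<lambda>(x, w). x # w) ` ({1..n} \<times> tuples n q)"
  unfolding tuples_def by (force simp: length_Suc_conv)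

text \<open>Erasing the first position preserves the total, which descends to the weight 1 of the
  empty word.\<close>

lemma sum_weight_tuples:
  assumes "triangle q \<le> n"
  shows "(\<Sum>w\<in>tuples n q. weight w) = 1"
  using assms
proof (induction q)
  case 0
  have "tuples n 0 = {[]}"
    by (auto simp: tuples_def)
  then show ?case
    by simp
next
  case (Suc q)
  have "(\<Sum>w\<in>tuples n (Suc q). weight w) = (\<Sum>(x, w)\<in>{1..n} \<times> tuples n q. weight (x # w))"
    unfolding tuples_Suc by (subst sum.reindex) (auto simp: inj_on_def intro!: sum.cong)
  also have "\<dots> = (\<Sum>w\<in>tuples n q. \<Sum>x\<in>{1..n}. weight (x # w))"
    by (subst sum.swap) (simp add: sum.cartesian_product)
  also have "\<dots> = (\<Sum>w\<in>tuples n q. weight w)"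
  proof (rule sum.cong)
    fix w assume "w \<in> tuples n q"
    then show "(\<Sum>x\<in>{1..n}. weight (x # w)) = weight w"
      using sum_weight_insert[of "[]" w n] Suc.prems by (simp add: tuples_def)
  qed simp
  also have "\<dots> = 1"
    using Suc by (simp add: triangle_Suc)
  finally show ?case .
qed

section \<open>Projections onto increasing tuples\<close>

lemma incr_tuples_corank_1:
  assumes "i \<in> incr_tuples (Suc m) m"
  obtains p where "p \<le> m" "i = [1..<Suc p] @ [Suc (Suc p)..<Suc (Suc m)]"
proof -
  have i: "sorted_wrt (<) i" "length i = m" "set i \<subseteq> {1..Suc m}"
    using assms by (auto simp: incr_tuples_def tuples_def)
  then have dist: "distinct i" "sorted i"
    by (auto simp: strict_sorted_iff)
  then have "card ({1..Suc m} - set i) = 1"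
    using i by (simp add: card_Diff_subset distinct_card)
  then obtain r where r: "{1..Suc m} - set i = {r}"
    by (auto simp: card_1_singleton_iff)
  then have "r \<in> {1..Suc m}" "set i = {1..Suc m} - {r}"
    using i(3) by blast+
  then obtain p where p: "p \<le> m" "set i = {1..Suc m} - {Suc p}"
    by (cases r) auto
  let ?j = "[1..<Suc p] @ [Suc (Suc p)..<Suc (Suc m)]"
  have "i = ?j"
  proof (rule sorted_distinct_set_unique)
    show "set i = set ?j"
      unfolding p(2) using p(1) by (auto simp del: upt_Suc)
  qed (use dist p(1) in \<open>auto simp: sorted_append simp del: upt_Suc\<close>)
  with p that show thesis
    by blast
qed

lemma subtuple_erase:
  assumes "length b = Suc m" "p \<le> m"
  shows "subtuple b ([1..<Suc p] @ [Suc (Suc p)..<Suc (Suc m)]) = take p b @ drop (Suc p) b"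
  unfolding subtuple_def
  by (rule nth_equalityI) (use assms in \<open>auto simp: nth_append simp del: upt_Suc\<close>)

text \<open>The right-hand side does not depend on \<open>i\<close>; this is the crystal
  property.\<close>

lemma projection_weight:
  assumes "i \<in> incr_tuples (Suc m) m" "triangle (Suc m) \<le> n"
  shows "projection n (Suc m) i (restrict weight (tuples n (Suc m))) = restrict weight (tuples n m)"
proof -
  obtain p where p: "p \<le> m" "i = [1..<Suc p] @ [Suc (Suc p)..<Suc (Suc m)]"
    using incr_tuples_corank_1[OF assms(1)] .
  have len: "length i = m"
    using assms(1) by (simp add: incr_tuples_def tuples_def)
  have "(\<Sum>b\<in>{b \<in> tuples n (Suc m). subtuple b i = a}. restrict weight (tuples n (Suc m)) b)
      = weight a" if a: "a \<in> tuples n m" for a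
  proof -
    let ?ins = "\<lambda>x. take p a @ x # drop p a"
    have la: "length a = m" "set a \<subseteq> {1..n}"
      using a by (auto simp: tuples_def)
    \<comment> \<open>The fibre over \<open>a\<close> consists of the words got by inserting one
      letter at the omitted position.\<close>
    have "{b \<in> tuples n (Suc m). subtuple b i = a} = ?ins ` {1..n}"
    proof (intro equalityI subsetI)
      fix b assume "b \<in> {b \<in> tuples n (Suc m). subtuple b i = a}"
      then have b: "length b = Suc m" "set b \<subseteq> {1..n}" "a = take p b @ drop (Suc p) b"
        using subtuple_erase[of b m p] p by (auto simp: tuples_def)
      then have "?ins (b ! p) = b"
        using p(1) by (simp add: id_take_nth_drop[symmetric])
      moreover have "b ! p \<in> {1..n}"
        using b(1,2) p(1) nth_mem[of p b] by (metis less_Suc_eq_le subsetD)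
      ultimately show "b \<in> ?ins ` {1..n}"
        by (metis imageI)
    next
      fix b assume "b \<in> ?ins ` {1..n}"
      then obtain x where x: "x \<in> {1..n}" "b = ?ins x"
        by auto
      have "set b \<subseteq> {1..n}"
        using x la(2) by (auto dest!: in_set_takeD in_set_dropD)
      moreover have "length b = Suc m"
        using x la p(1) by simp
      moreover have "subtuple b i = a"
        using subtuple_erase[OF \<open>length b = Suc m\<close> p(1)] p la x(2) by simp
      ultimately show "b \<in> {b \<in> tuples n (Suc m). subtuple b i = a}"
        by (simp add: tuples_def)
    qed
    moreover have "inj_on ?ins {1..n}"
      by (auto simp: inj_on_def)
    moreover have "(\<Sum>b\<in>{b \<in> tuples n (Suc m). subtuple b i = a}.
        restrict weight (tuples n (Suc m)) b) = (\<Sum>b\<in>{b \<in> tuples n (Suc m). subtuple b i = a}. weight b)"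
      by (rule sum.cong) auto
    ultimately have "(\<Sum>b\<in>{b \<in> tuples n (Suc m). subtuple b i = a}.
        restrict weight (tuples n (Suc m)) b) = (\<Sum>x\<in>{1..n}. weight (?ins x))"
      by (simp add: sum.reindex)
    also have "\<dots> = weight a"
      using sum_weight_insert[of "take p a" "drop p a" n] la assms(2) by simp
    finally show ?thesis .
  qed
  then show ?thesis
    unfolding projection_def len by (intro restrict_ext) auto
qed

theorem theorem2p5:
  fixes k :: nat
  assumes "k \<ge> 1"
  shows "\<exists>C \<in> tensors ((k^2 + k) div 2) k.
           hollow ((k^2 + k) div 2) k C \<and>
           affine_tensor ((k^2 + k) div 2) k C \<and>
           crystal ((k^2 + k) div 2) k (k - 1) C"
proof -
  obtain m where k: "k = Suc m"
    using assms by (cases k) auto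
  let ?n = "triangle k"
  let ?C = "restrict weight (tuples ?n k)"
  have "?C \<in> tensors ?n k"
    by (simp add: tensors_def)
  moreover have "hollow ?n k ?C"
    using weight_nonzero_distinct by (auto simp: hollow_def)
  moreover have "affine_tensor ?n k ?C"
    using sum_weight_tuples[of k ?n] by (simp add: affine_tensor_def)
  moreover have "crystal ?n k (k - 1) ?C"
    by (simp add: crystal_def k projection_weight)
  ultimately show ?thesis
    unfolding triangle_def by blast
qed

end
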